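(* Every number constructible with straightedge and compass is an origami number: $\mathbb{E}\subseteq\mathbb{O}$.
   Context: Work in the Cartesian plane $\mathbb{R}^2$. Straightedge-and-compass numbers: a point is a ZuL-point if it is the last point of a finite sequence $P_1,\dots,P_n$ of points such that each point of the sequence is either one of the starting points $(0,0),(0,1)$ or is obtained in one of the following ways: (1) as an intersection point of two (distinct) lines, each passing through two (distinct) points occurring earlier in the sequence; (2) as an intersection point of a line through two points occurring earlier with a circle whose centre is an earlier point and which passes through another earlier point; (3) as an intersection point of two (distinct) circles, each having an earlier point as centre and passing through an earlier point. A real number $x$ is a ZuL-number if $(x,0)$ is a ZuL-point. $\mathbb{E}$ denotes the set of ZuL-numbers. Origami numbers: for a line $t$, let $P^t$ denote the reflection of the point $P$ in $t$. A line is an origami line if it is the last of a finite sequence of lines $t_1,\dots,t_n$ such that each line of the sequence is either one of the starting lines $x=0$, $y=0$, $x+y=1$, or is a line $t$ for which there are lines $p,q$ and points $P,Q$ with $P^t\in p$ and $Q^t\in q$, where: $p$ and $q$ are non-parallel lines occurring earlier in the sequence; $P$ and $Q$ are distinct points, each of which is the intersection of two lines occurring earlier in the sequence; and either $q$ is the line through $P$ and $Q$, or $p\perp q$. An origami point is a point that is the intersection of two (distinct) origami lines. A real number $x$ is an origami number if $(x,0)$ is an origami point. $\mathbb{O}$ denotes the set of origami numbers. *)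

theory Defs
  imports "HOL-Analysis.Analysis"
begin

text \<open>On the product type the library's \<^const>\<open>dist\<close> and \<^const>\<open>inner\<close> are the Euclidean ones.\<close>

type_synonym point = "real \<times> real"

definition line_through :: "point \<Rightarrow> point \<Rightarrow> point set" where
  "line_through P Q = affine hull {P, Q}"

definition is_line :: "point set \<Rightarrow> bool" where
  "is_line l \<longleftrightarrow> (\<exists>P Q. P \<noteq> Q \<and> l = line_through P Q)"

definition circle_through :: "point \<Rightarrow> point \<Rightarrow> point set" where
  "circle_through C P = sphere C (dist C P)"

definition lines_of :: "point set \<Rightarrow> point set set" where
  "lines_of S = {line_through P Q | P Q. P \<in> S \<and> Q \<in> S \<and> P \<noteq> Q}"

text \<open>The condition \<open>C \<noteq> P\<close> excludes circles of radius zero.\<close>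

definition circles_of :: "point set \<Rightarrow> point set set" where
  "circles_of S = {circle_through C P | C P. C \<in> S \<and> P \<in> S \<and> C \<noteq> P}"

definition zul_step :: "point set \<Rightarrow> point \<Rightarrow> bool" where
  "zul_step S X \<longleftrightarrow>
     (\<exists>l\<in>lines_of S. \<exists>m\<in>lines_of S. l \<noteq> m \<and> X \<in> l \<inter> m) \<or>
     (\<exists>l\<in>lines_of S. \<exists>c\<in>circles_of S. X \<in> l \<inter> c) \<or>
     (\<exists>c\<in>circles_of S. \<exists>d\<in>circles_of S. c \<noteq> d \<and> X \<in> c \<inter> d)"

definition zul_sequence :: "point list \<Rightarrow> bool" where
  "zul_sequence Ps \<longleftrightarrow>
     (\<forall>i<length Ps. Ps ! i \<in> {(0, 0), (0, 1)} \<or> zul_step (set (take i Ps)) (Ps ! i))"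

definition zul_point :: "point \<Rightarrow> bool" where
  "zul_point P \<longleftrightarrow> (\<exists>Ps. Ps \<noteq> [] \<and> zul_sequence Ps \<and> last Ps = P)"

definition zul_numbers :: "real set" where
  "zul_numbers = {x. zul_point (x, 0)}"

text \<open>For a line \<open>t\<close>, the point of \<open>t\<close> closest to \<open>P\<close> is the foot of the perpendicular from \<open>P\<close>,
  that is, the midpoint of \<open>P\<close> and its mirror image.\<close>

definition reflection :: "point set \<Rightarrow> point \<Rightarrow> point" where
  "reflection t P = 2 *\<^sub>R closest_point t P - P"

definition perpendicular :: "point set \<Rightarrow> point set \<Rightarrow> bool" where
  "perpendicular p q \<longleftrightarrow> (\<forall>A\<in>p. \<forall>B\<in>p. \<forall>C\<in>q. \<forall>D\<in>q. orthogonal (B - A) (D - C))"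

definition is_meet :: "point set set \<Rightarrow> point \<Rightarrow> bool" where
  "is_meet T P \<longleftrightarrow> (\<exists>l\<in>T. \<exists>m\<in>T. l \<noteq> m \<and> l \<inter> m = {P})"

text \<open>Parallelism is \<^const>\<open>affine_parallel\<close>, for which every line is parallel to itself;
  so the non-parallel lines \<open>p\<close> and \<open>q\<close> below are in particular distinct.\<close>

definition origami_step :: "point set set \<Rightarrow> point set \<Rightarrow> bool" where
  "origami_step T t \<longleftrightarrow> is_line t \<and>
     (\<exists>p q P Q. p \<in> T \<and> q \<in> T \<and> \<not> affine_parallel p q \<and>
        P \<noteq> Q \<and> is_meet T P \<and> is_meet T Q \<and>
        (q = line_through P Q \<or> perpendicular p q) \<and>
        reflection t P \<in> p \<and> reflection t Q \<in> q)"

definition origami_start :: "point set set" where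
  "origami_start = {{(x, y). x = 0}, {(x, y). y = 0}, {(x, y). x + y = 1}}"

definition origami_sequence :: "point set list \<Rightarrow> bool" where
  "origami_sequence ts \<longleftrightarrow>
     (\<forall>i<length ts. ts ! i \<in> origami_start \<or> origami_step (set (take i ts)) (ts ! i))"

definition origami_line :: "point set \<Rightarrow> bool" where
  "origami_line t \<longleftrightarrow> (\<exists>ts. ts \<noteq> [] \<and> origami_sequence ts \<and> last ts = t)"

definition origami_point :: "point \<Rightarrow> bool" where
  "origami_point P \<longleftrightarrow> is_meet {t. origami_line t} P"

definition origami_numbers :: "real set" where
  "origami_numbers = {x. origami_point (x, 0)}"

end

theory Submission
  imports Defs
begin

text \<open>Folds give perpendiculars through origami points. Two distinct origami points \<open>P\<close>, \<open>Q\<close> can then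
  be joined by a fold with \<open>p\<close> the vertical through \<open>P\<close> and \<open>q\<close> the horizontal through \<open>Q\<close>. So the
  origami points are the points with origami coordinates, and the similar-triangle constructions make
  the origami numbers a field. It is closed under square roots of nonnegative numbers, and every such
  field contains the coordinates of all straightedge-and-compass points.\<close>

section \<open>Lines in coordinates\<close>

definition lin :: "real \<Rightarrow> real \<Rightarrow> real \<Rightarrow> point set" where
  "lin a b c = {(x, y). a * x + b * y = c}"

lemma mem_lin [simp]: "(x, y) \<in> lin a b c \<longleftrightarrow> a * x + b * y = c"
  by (simp add: lin_def)

lemma lin_scale: "k \<noteq> 0 \<Longrightarrow> lin (k * a) (k * b) (k * c) = lin a b c"
  by (auto simp: lin_def mult.assoc simp flip: distrib_left)

lemma line_through_eq_lin:
  assumes "(x1, y1) \<noteq> (x2, y2)"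
  shows "line_through (x1, y1) (x2, y2)
    = lin (y2 - y1) (x1 - x2) ((y2 - y1) * x1 + (x1 - x2) * y1)" (is "?L = ?R")
proof
  show "?L \<subseteq> ?R"
    by (auto simp: line_through_def affine_hull_2_alt algebra_simps)
  show "?R \<subseteq> ?L"
  proof clarify
    fix x y assume "(x, y) \<in> ?R"
    then have eq: "(y2 - y1) * (x - x1) = (x2 - x1) * (y - y1)"
      by (simp add: algebra_simps)
    have "\<exists>u. x = x1 + u * (x2 - x1) \<and> y = y1 + u * (y2 - y1)"
    proof (cases "x1 = x2")
      case True
      then show ?thesis using eq assms
        by (intro exI[of _ "(y - y1) / (y2 - y1)"]) auto
    next
      case False
      then show ?thesis using eq
        by (intro exI[of _ "(x - x1) / (x2 - x1)"]) (auto simp: field_simps)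
    qed
    then show "(x, y) \<in> ?L"
      by (auto simp: line_through_def affine_hull_2_alt)
  qed
qed

lemma lin_eq_line_through:
  assumes "(a, b) \<noteq> (0, 0)" "(x1, y1) \<in> lin a b c" "(x2, y2) \<in> lin a b c" "(x1, y1) \<noteq> (x2, y2)"
  shows "line_through (x1, y1) (x2, y2) = lin a b c"
proof -
  have eq: "a * (x2 - x1) = b * (y1 - y2)"
    using assms(2,3) by (simp add: algebra_simps)
  \<comment> \<open>Both \<open>(a, b)\<close> and \<open>(y2 - y1, x1 - x2)\<close> are normal to
    the segment joining the two points, so they are proportional.\<close>
  obtain k where k: "y2 - y1 = k * a" "x1 - x2 = k * b"
  proof (cases "a = 0")
    case True
    then show ?thesis using eq assms(1) that[of "(x1 - x2) / b"] by auto
  next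
    case False
    have "x1 - x2 = (y2 - y1) / a * b" using eq False by (simp add: field_simps)
    then show ?thesis using False that[of "(y2 - y1) / a"] by auto
  qed
  then have "k \<noteq> 0" using assms(4) by auto
  have "(y2 - y1) * x1 + (x1 - x2) * y1 = k * (a * x1 + b * y1)"
    by (simp add: k algebra_simps)
  then have "(y2 - y1) * x1 + (x1 - x2) * y1 = k * c"
    using assms(2) by simp
  then show ?thesis
    unfolding line_through_eq_lin[OF assms(4)] k using lin_scale[OF \<open>k \<noteq> 0\<close>] by simp
qed

lemma is_line_iff_lin: "is_line l \<longleftrightarrow> (\<exists>a b c. (a, b) \<noteq> (0, 0) \<and> l = lin a b c)"
proof
  assume "is_line l"
  then obtain x1 y1 x2 y2 where "(x1, y1) \<noteq> (x2, y2)" "l = line_through (x1, y1) (x2, y2)"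
    by (auto simp: is_line_def)
  then have "(y2 - y1, x1 - x2) \<noteq> (0, 0)"
      "l = lin (y2 - y1) (x1 - x2) ((y2 - y1) * x1 + (x1 - x2) * y1)"
    by (auto simp: line_through_eq_lin)
  then show "\<exists>a b c. (a, b) \<noteq> (0, 0) \<and> l = lin a b c"
    by blast
next
  assume "\<exists>a b c. (a, b) \<noteq> (0, 0) \<and> l = lin a b c"
  then obtain a b c where ab: "(a, b) \<noteq> (0, 0)" and l: "l = lin a b c"
    by blast
  define s where "s = a\<^sup>2 + b\<^sup>2"
  have "s \<noteq> 0" using ab by (auto simp: s_def sum_power2_eq_zero_iff)
  \<comment> \<open>\<open>(x, y)\<close> is the foot of the perpendicular from the origin; adding
    the direction vector \<open>(- b, a)\<close> gives a second point.\<close>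
  define x where "x = a * c / s"
  define y where "y = b * c / s"
  have "a * x + b * y = c * s / s"
    by (simp add: x_def y_def s_def power2_eq_square add_divide_distrib algebra_simps)
  then have "(x, y) \<in> l" "(x - b, y + a) \<in> l"
    using \<open>s \<noteq> 0\<close> by (auto simp: l algebra_simps)
  then have "line_through (x, y) (x - b, y + a) = l"
    unfolding l using ab by (intro lin_eq_line_through) auto
  then show "is_line l"
    unfolding is_line_def using ab
    by (intro exI[of _ "(x, y)"] exI[of _ "(x - b, y + a)"]) auto
qed

section \<open>Parallel, intersecting and perpendicular lines; reflections\<close>

lemma is_line_lin: "(a, b) \<noteq> (0, 0) \<Longrightarrow> is_line (lin a b c)"
  using is_line_iff_lin by blast

text \<open>With proportional normals, the shift of the common point by \<open>(- b, a)\<close> lies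
  on both lines, and two points determine a line.\<close>

lemma lin_eq_of_parallel:
  assumes "(a, b) \<noteq> (0, 0)" "(a', b') \<noteq> (0, 0)" "a * b' = a' * b"
    and "(x, y) \<in> lin a b c" "(x, y) \<in> lin a' b' c'"
  shows "lin a b c = lin a' b' c'"
proof -
  have 1: "(x - b, y + a) \<in> lin a b c" "(x - b, y + a) \<in> lin a' b' c'"
    using assms(3-5) by (auto simp: algebra_simps)
  then show ?thesis
    using lin_eq_line_through[OF assms(1,4) 1(1)] lin_eq_line_through[OF assms(2,5) 1(2)] assms(1)
    by auto
qed

lemma lin_Int_lin:
  assumes "a * b' \<noteq> a' * b" "(x, y) \<in> lin a b c" "(x, y) \<in> lin a' b' c'"
  shows "lin a b c \<inter> lin a' b' c' = {(x, y)}"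
proof -
  have uniq: "u = x \<and> v = y" if "a * u + b * v = c" "a' * u + b' * v = c'" for u v
  proof -
    have *: "a * (u - x) + b * (v - y) = 0" "a' * (u - x) + b' * (v - y) = 0"
      using that assms(2,3) by (simp_all add: right_diff_distrib)
    \<comment> \<open>Cramer's rule for the homogeneous system satisfied by the difference of the
      two solutions.\<close>
    have "(a * b' - a' * b) * (u - x) = b' * (a * (u - x) + b * (v - y)) - b * (a' * (u - x) + b' * (v - y))"
      "(a * b' - a' * b) * (v - y) = a * (a' * (u - x) + b' * (v - y)) - a' * (a * (u - x) + b * (v - y))"
      by (simp_all add: algebra_simps)
    then show ?thesis unfolding * using assms(1) by auto
  qed
  have "lin a b c \<inter> lin a' b' c' \<subseteq> {(x, y)}"
    using uniq unfolding lin_def by blast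
  then show ?thesis using assms(2,3) by blast
qed

lemma lin_meet_exists:
  assumes "a * b' \<noteq> a' * b"
  obtains x y where "(x, y) \<in> lin a b c" "(x, y) \<in> lin a' b' c'"
proof
  define d where "d = a * b' - a' * b"
  have "d \<noteq> 0" using assms by (simp add: d_def)
  have "a * ((c * b' - c' * b) / d) + b * ((a * c' - a' * c) / d) = c * d / d"
    "a' * ((c * b' - c' * b) / d) + b' * ((a * c' - a' * c) / d) = c' * d / d"
    by (simp_all add: d_def algebra_simps diff_divide_distrib)
  then show "((c * b' - c' * b) / d, (a * c' - a' * c) / d) \<in> lin a b c"
    "((c * b' - c' * b) / d, (a * c' - a' * c) / d) \<in> lin a' b' c'"
    using \<open>d \<noteq> 0\<close> by auto
qed

text \<open>A translation preserves the direction \<open>(- b, a)\<close>, so that direction would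
  also have to be orthogonal to \<open>(a', b')\<close>.\<close>

lemma not_affine_parallel_lin:
  assumes "a * b' \<noteq> a' * b"
  shows "\<not> affine_parallel (lin a b c) (lin a' b' c')"
proof
  assume "affine_parallel (lin a b c) (lin a' b' c')"
  then obtain v1 v2 where v: "lin a' b' c' = (\<lambda>X. (v1, v2) + X) ` lin a b c"
    unfolding affine_parallel_def by auto
  obtain x y where xy: "(x, y) \<in> lin a b c"
    using lin_meet_exists[OF assms] by metis
  then have "(x - b, y + a) \<in> lin a b c"
    by (simp add: algebra_simps)
  then have "(v1, v2) + (x, y) \<in> lin a' b' c'" "(v1, v2) + (x - b, y + a) \<in> lin a' b' c'"
    unfolding v using xy by blast+
  then show False using assms by (auto simp: algebra_simps)
qed

lemma perpendicular_lin:
  assumes "a * a' + b * b' = 0" "(a, b) \<noteq> (0, 0)" "(a', b') \<noteq> (0, 0)"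
  shows "perpendicular (lin a b c) (lin a' b' c')"
proof -
  have dir: "\<exists>k. x2 - x1 = - k * b \<and> y2 - y1 = k * a"
    if "(a, b) \<noteq> (0, 0)" "a * x1 + b * y1 = c" "a * x2 + b * y2 = c" for a b c x1 y1 x2 y2 :: real
  proof (cases "a = 0")
    case True
    then show ?thesis using that by (intro exI[of _ "(x1 - x2) / b"]) auto
  next
    case False
    have "a * (x2 - x1) + b * (y2 - y1) = 0"
      using that by (simp add: algebra_simps)
    then show ?thesis using False by (intro exI[of _ "(y2 - y1) / a"]) (auto simp: field_simps)
  qed
  have "(x2 - x1) * (x4 - x3) + (y2 - y1) * (y4 - y3) = 0"
    if on: "a * x1 + b * y1 = c" "a * x2 + b * y2 = c" "a' * x3 + b' * y3 = c'" "a' * x4 + b' * y4 = c'"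
    for x1 y1 x2 y2 x3 y3 x4 y4
  proof -
    obtain k where k: "x2 - x1 = - k * b" "y2 - y1 = k * a"
      using dir[OF assms(2) on(1,2)] by auto
    obtain l where l: "x4 - x3 = - l * b'" "y4 - y3 = l * a'"
      using dir[OF assms(3) on(3,4)] by auto
    have "(x2 - x1) * (x4 - x3) + (y2 - y1) * (y4 - y3) = k * l * (a * a' + b * b')"
      unfolding k l by (simp add: algebra_simps)
    then show ?thesis using assms(1) by simp
  qed
  then show ?thesis
    by (auto simp: perpendicular_def orthogonal_def)
qed

text \<open>\<open>(x + k * a, y + k * b)\<close> is the foot of the perpendicular: it lies on the
  line and differs from \<open>(x, y)\<close> by a multiple of the normal. Supplying
  \<open>k\<close> avoids a quotient by \<open>a\<^sup>2 + b\<^sup>2\<close>.\<close>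

lemma reflection_lin:
  assumes "(a, b) \<noteq> (0, 0)" "x' = x + 2 * k * a" "y' = y + 2 * k * b"
    and "a * (x + k * a) + b * (y + k * b) = c"
  shows "reflection (lin a b c) (x, y) = (x', y')"
proof -
  have l: "is_line (lin a b c)" using assms(1) by (rule is_line_lin)
  then have "affine (lin a b c)"
    by (auto simp: is_line_def line_through_def)
  then have "convex (lin a b c)" "closed (lin a b c)"
    by (auto simp: affine_imp_convex affine_closed)
  moreover have "dist (x, y) (x + k * a, y + k * b) \<le> dist (x, y) z" if "z \<in> lin a b c" for z
  proof -
    obtain u v where z: "z = (u, v)" by fastforce
    have eq: "a * (u - x - k * a) + b * (v - y - k * b) = 0"
      using that assms(4) by (simp add: z algebra_simps)
    \<comment> \<open>Pythagoras: the last summand is the inner product of the two legs, which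
      vanishes by \<open>eq\<close>.\<close>
    have "(x - u)\<^sup>2 + (y - v)\<^sup>2 = (k * a)\<^sup>2 + (k * b)\<^sup>2 + (u - x - k * a)\<^sup>2 + (v - y - k * b)\<^sup>2
        + 2 * k * (a * (u - x - k * a) + b * (v - y - k * b))"
      by (simp add: power2_eq_square algebra_simps)
    then have "(k * a)\<^sup>2 + (k * b)\<^sup>2 \<le> (x - u)\<^sup>2 + (y - v)\<^sup>2"
      unfolding eq by simp
    then show ?thesis
      by (simp add: z dist_Pair_Pair dist_real_def)
  qed
  ultimately have "closest_point (lin a b c) (x, y) = (x + k * a, y + k * b)"
    using assms(4) by (intro closest_point_unique[symmetric]) auto
  then show ?thesis using assms(2,3) by (simp add: reflection_def)
qed

section \<open>Origami lines and points\<close>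

lemma is_meet_mono: "is_meet S P \<Longrightarrow> S \<subseteq> T \<Longrightarrow> is_meet T P"
  unfolding is_meet_def by blast

lemma origami_step_mono: "origami_step S t \<Longrightarrow> S \<subseteq> T \<Longrightarrow> origami_step T t"
  unfolding origami_step_def using is_meet_mono[of S _ T] by blast

lemma is_meet_finite:
  assumes "is_meet T P"
  obtains S where "finite S" "S \<subseteq> T" "is_meet S P"
proof -
  obtain l m where "l \<in> T" "m \<in> T" "l \<noteq> m" "l \<inter> m = {P}"
    using assms by (auto simp: is_meet_def)
  then show ?thesis by (intro that[of "{l, m}"]) (auto simp: is_meet_def)
qed

text \<open>A fold uses \<open>p\<close>, \<open>q\<close> and two lines for each of
  \<open>P\<close> and \<open>Q\<close>. Finiteness matters because only finitely many sequences can
  be concatenated.\<close>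

lemma origami_step_finite:
  assumes "origami_step T t"
  obtains S where "finite S" "S \<subseteq> T" "origami_step S t"
proof -
  obtain p q P Q where *: "p \<in> T" "q \<in> T" "\<not> affine_parallel p q" "P \<noteq> Q"
      "is_meet T P" "is_meet T Q" "q = line_through P Q \<or> perpendicular p q"
      "reflection t P \<in> p" "reflection t Q \<in> q" and t: "is_line t"
    using assms unfolding origami_step_def by blast
  obtain S1 where S1: "finite S1" "S1 \<subseteq> T" "is_meet S1 P"
    using is_meet_finite *(5) by blast
  obtain S2 where S2: "finite S2" "S2 \<subseteq> T" "is_meet S2 Q"
    using is_meet_finite *(6) by blast
  define S where "S = {p, q} \<union> S1 \<union> S2"
  have "p \<in> S" "q \<in> S" "is_meet S P" "is_meet S Q"
    using S1(3) S2(3) by (auto simp: S_def intro: is_meet_mono)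
  then have "origami_step S t"
    unfolding origami_step_def using t *(3,4,7-9) by blast
  moreover have "finite S" "S \<subseteq> T" using S1 S2 *(1,2) by (auto simp: S_def)
  ultimately show ?thesis using that by blast
qed

lemma origami_sequence_append:
  assumes "origami_sequence xs" "origami_sequence ys"
  shows "origami_sequence (xs @ ys)"
  unfolding origami_sequence_def
proof (intro allI impI)
  fix i assume i: "i < length (xs @ ys)"
  show "(xs @ ys) ! i \<in> origami_start \<or> origami_step (set (take i (xs @ ys))) ((xs @ ys) ! i)"
  proof (cases "i < length xs")
    case True
    then show ?thesis using assms(1) by (auto simp: origami_sequence_def nth_append)
  next
    case False
    then have "ys ! (i - length xs) \<in> origami_start
        \<or> origami_step (set (take (i - length xs) ys)) (ys ! (i - length xs))"
      using assms(2) i by (auto simp: origami_sequence_def)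
    then show ?thesis using False
      by (auto simp: nth_append intro: origami_step_mono)
  qed
qed

lemma origami_sequence_snoc:
  assumes "origami_sequence xs" "t \<in> origami_start \<or> origami_step (set xs) t"
  shows "origami_sequence (xs @ [t])"
  using assms by (auto simp: origami_sequence_def nth_append less_Suc_eq)

lemma origami_sequence_covering:
  assumes "finite S" "S \<subseteq> {t. origami_line t}"
  shows "\<exists>ts. origami_sequence ts \<and> S \<subseteq> set ts"
  using assms
proof (induction S rule: finite_induct)
  case empty
  then show ?case by (intro exI[of _ "[]"]) (simp add: origami_sequence_def)
next
  case (insert t S)
  then obtain ts us where "origami_sequence ts" "S \<subseteq> set ts"
      "us \<noteq> []" "origami_sequence us" "last us = t"
    by (auto simp: origami_line_def)
  then show ?case
    by (intro exI[of _ "us @ ts"]) (auto intro: origami_sequence_append)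
qed

text \<open>The finitely many lines used by the fold have sequences of their own; after their
  concatenation, \<open>t\<close> can be appended as the last line.\<close>

lemma origami_line_step:
  assumes "origami_step {t. origami_line t} t"
  shows "origami_line t"
proof -
  obtain S where S: "finite S" "S \<subseteq> {t. origami_line t}" "origami_step S t"
    using origami_step_finite[OF assms] .
  obtain ts where ts: "origami_sequence ts" "S \<subseteq> set ts"
    using origami_sequence_covering[OF S(1,2)] by blast
  then have "origami_sequence (ts @ [t])"
    using S(3) by (intro origami_sequence_snoc) (auto intro: origami_step_mono)
  then show ?thesis unfolding origami_line_def by (intro exI[of _ "ts @ [t]"]) auto
qed

lemma origami_line_start: "t \<in> origami_start \<Longrightarrow> origami_line t"
  unfolding origami_line_def by (intro exI[of _ "[t]"]) (auto simp: origami_sequence_def)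

section \<open>Origami lines and points in coordinates\<close>

lemma origami_start_eq_lin: "origami_start = {lin 1 0 0, lin 0 1 0, lin 1 1 1}"
  by (simp add: origami_start_def lin_def)

lemma origami_axes: "origami_line (lin 1 0 0)" "origami_line (lin 0 1 0)" "origami_line (lin 1 1 1)"
  by (simp_all add: origami_line_start origami_start_eq_lin)

lemma origami_line_lin:
  assumes "origami_line t"
  obtains a b c where "(a, b) \<noteq> (0, 0)" "t = lin a b c"
proof -
  obtain ts where ts: "ts \<noteq> []" "origami_sequence ts" "t = last ts"
    using assms by (auto simp: origami_line_def)
  then have "t \<in> origami_start \<or> origami_step (set (take (length ts - 1) ts)) t"
    by (simp add: origami_sequence_def last_conv_nth)
  then have "t \<in> origami_start \<or> is_line t"
    by (auto simp only: origami_step_def)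
  moreover have "is_line (lin 1 0 0)" "is_line (lin 0 1 0)" "is_line (lin 1 1 1)"
    by (simp_all add: is_line_lin)
  ultimately have "is_line t"
    by (auto simp only: origami_start_eq_lin)
  then show ?thesis using that by (auto simp: is_line_iff_lin)
qed

lemma origami_pointI:
  assumes "origami_line (lin a b c)" "origami_line (lin a' b' c')" "a * b' \<noteq> a' * b"
    and "a * x + b * y = c" "a' * x + b' * y = c'"
  shows "origami_point (x, y)"
proof -
  have "\<not> affine_parallel (lin a b c) (lin a' b' c')"
    using not_affine_parallel_lin assms(3) .
  then have "lin a b c \<noteq> lin a' b' c'"
    using affine_parallel_reflex by metis
  moreover have "lin a b c \<inter> lin a' b' c' = {(x, y)}"
    using assms by (intro lin_Int_lin) auto
  ultimately show ?thesis
    unfolding origami_point_def is_meet_def using assms(1,2) by blast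
qed

lemma origami_pointE:
  assumes "origami_point (x, y)"
  obtains a b c a' b' c' where "origami_line (lin a b c)" "origami_line (lin a' b' c')"
    "a * b' \<noteq> a' * b" "a * x + b * y = c" "a' * x + b' * y = c'"
proof -
  obtain l m where lm: "origami_line l" "origami_line m" "l \<noteq> m" "l \<inter> m = {(x, y)}"
    using assms by (auto simp: origami_point_def is_meet_def)
  obtain a b c where l: "(a, b) \<noteq> (0, 0)" "l = lin a b c"
    using origami_line_lin lm(1) .
  obtain a' b' c' where m: "(a', b') \<noteq> (0, 0)" "m = lin a' b' c'"
    using origami_line_lin lm(2) .
  have xy: "(x, y) \<in> lin a b c" "(x, y) \<in> lin a' b' c'"
    using lm(4) unfolding l(2) m(2) by blast+
  moreover have "a * b' \<noteq> a' * b"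
    using lin_eq_of_parallel[OF l(1) m(1) _ xy] lm(3) l m by auto
  ultimately show ?thesis using that lm(1,2) l(2) m(2) by simp
qed

text \<open>The working form of a fold: \<open>p\<close> is \<open>lin a b c\<close>,
  \<open>q\<close> is \<open>lin a' b' c'\<close>, and \<open>P\<close>, \<open>Q\<close> are the
  two given points. The numbers \<open>k\<close> and \<open>l\<close> locate the feet of their
  perpendiculars on the fold line, as in \<open>reflection_lin\<close>; the value 0 means that the
  point stays fixed.\<close>

lemma origami_fold:
  assumes "origami_line (lin a b c)" "origami_line (lin a' b' c')" "a * b' \<noteq> a' * b"
    and "origami_point (x1, y1)" "origami_point (x2, y2)" "(x1, y1) \<noteq> (x2, y2)"
    and "a' * x1 + b' * y1 = c' \<and> a' * x2 + b' * y2 = c' \<or> a * a' + b * b' = 0"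
    and "(u, v) \<noteq> (0, 0)"
    and "u * (x1 + k * u) + v * (y1 + k * v) = w" "a * (x1 + 2 * k * u) + b * (y1 + 2 * k * v) = c"
    and "u * (x2 + l * u) + v * (y2 + l * v) = w" "a' * (x2 + 2 * l * u) + b' * (y2 + 2 * l * v) = c'"
  shows "origami_line (lin u v w)"
proof (rule origami_line_step)
  have nz: "(a, b) \<noteq> (0, 0)" "(a', b') \<noteq> (0, 0)"
    using assms(3) by auto
  have "lin a' b' c' = line_through (x1, y1) (x2, y2) \<or> perpendicular (lin a b c) (lin a' b' c')"
    using assms(6,7) nz perpendicular_lin lin_eq_line_through
    by (metis mem_lin)
  moreover have "reflection (lin u v w) (x1, y1) \<in> lin a b c"
    using assms(10) by (subst reflection_lin[OF assms(8) refl refl assms(9)]) simp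
  moreover have "reflection (lin u v w) (x2, y2) \<in> lin a' b' c'"
    using assms(12) by (subst reflection_lin[OF assms(8) refl refl assms(11)]) simp
  moreover have "is_line (lin u v w)" using assms(8) by (rule is_line_lin)
  ultimately show "origami_step {t. origami_line t} (lin u v w)"
    using assms(1,2,4-6) not_affine_parallel_lin[OF assms(3)]
    unfolding origami_step_def origami_point_def by blast
qed

section \<open>Basic folds: perpendiculars, parallels and joining lines\<close>

lemma origami_corners: "origami_point (0, 0)" "origami_point (1, 0)" "origami_point (0, 1)"
  by (rule origami_pointI[OF origami_axes(1,2)] origami_pointI[OF origami_axes(2,3)]
      origami_pointI[OF origami_axes(1,3)]; simp)+

text \<open>Each fold swaps the origin with \<open>(1, 0)\<close> or \<open>(0, 1)\<close>. The axis
  containing both points serves as \<open>q\<close>, the other one as \<open>p\<close>.\<close>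

lemma origami_half: "origami_line (lin 1 0 (1/2))" "origami_line (lin 0 1 (1/2))"
proof -
  show "origami_line (lin 1 0 (1/2))"
    by (rule origami_fold[OF origami_axes(1,2) _ origami_corners(2,1), where k = "-1/2" and l = "1/2"]) auto
  show "origami_line (lin 0 1 (1/2))"
    by (rule origami_fold[OF origami_axes(2,1) _ origami_corners(3,1), where k = "-1/2" and l = "1/2"]) auto
qed

text \<open>Supplies the second point that a fold needs. A vertical line meets \<open>y = 0\<close>
  and \<open>y = 1/2\<close>, any other line meets \<open>x = 0\<close> and \<open>x = 1/2\<close>;
  at least one of the two points differs from \<open>(x, y)\<close>.\<close>

lemma origami_second_point:
  assumes "origami_line (lin a b c)" "(a, b) \<noteq> (0, 0)"
  obtains x' y' where "origami_point (x', y')" "a * x' + b * y' = c" "(x', y') \<noteq> (x, y)"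
proof (cases "b = 0")
  case True
  then have "a \<noteq> 0" using assms(2) by auto
  have "origami_point (c / a, 0)" "origami_point (c / a, 1/2)"
    by (rule origami_pointI[OF assms(1) origami_axes(2)] origami_pointI[OF assms(1) origami_half(2)];
        simp add: True \<open>a \<noteq> 0\<close>)+
  then show ?thesis using that True \<open>a \<noteq> 0\<close> by (cases "y = 0") force+
next
  case False
  have "origami_point (0, c / b)" "origami_point (1/2, (c - a / 2) / b)"
    by (rule origami_pointI[OF assms(1) origami_axes(1)] origami_pointI[OF assms(1) origami_half(1)];
        simp add: False)+
  then show ?thesis using that[of 0 "c / b"] that[of "1/2" "(c - a / 2) / b"] False
    by (cases "x = 0") auto
qed

text \<open>Both folds below fix \<open>(x, y)\<close> and reflect the given line \<open>lin a b c\<close> to itself. If \<open>(x, y)\<close> lies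
  on that line, it plays the role of \<open>q\<close>, and otherwise that of \<open>p\<close>.\<close>

lemma origami_perpendicular:
  assumes "origami_point (x, y)" "origami_line (lin a b c)" "(a, b) \<noteq> (0, 0)"
  shows "origami_line (lin b (- a) (b * x - a * y))"
proof -
  obtain a1 b1 c1 a2 b2 c2 where 1: "origami_line (lin a1 b1 c1)" "a1 * x + b1 * y = c1"
    and 2: "origami_line (lin a2 b2 c2)" "a2 * x + b2 * y = c2" and ne: "a1 * b2 \<noteq> a2 * b1"
    using origami_pointE[OF assms(1)] by metis
  \<comment> \<open>Of two non-parallel lines through \<open>(x, y)\<close>, at least one is not
    parallel to \<open>lin a b c\<close>.\<close>
  have "a1 * b \<noteq> a * b1 \<or> a2 * b \<noteq> a * b2"
  proof (rule ccontr)
    assume "\<not> ?thesis"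
    then have "a1 * b = a * b1" "a2 * b = a * b2" by auto
    then have "a * (a1 * b2 - a2 * b1) = 0" "b * (a1 * b2 - a2 * b1) = 0"
      by algebra+
    then show False using ne assms(3) by auto
  qed
  then obtain a' b' c' where q: "origami_line (lin a' b' c')" "a' * x + b' * y = c'" "a * b' \<noteq> a' * b"
    using 1 2 by (metis mult.commute)
  show ?thesis
  proof (cases "a * x + b * y = c")
    case True
    obtain x' y' where P: "origami_point (x', y')" "a * x' + b * y' = c" "(x', y') \<noteq> (x, y)"
      using origami_second_point[OF assms(2,3)] .
    define s where "s = a\<^sup>2 + b\<^sup>2"
    have "s \<noteq> 0" using assms(3) by (auto simp: s_def sum_power2_eq_zero_iff)
    \<comment> \<open>Chosen so that moving \<open>(x', y')\<close> by \<open>l\<close> times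
      \<open>(b, - a)\<close>, hence along \<open>lin a b c\<close>, leads to the fold line.\<close>
    define l where "l = (b * (x - x') - a * (y - y')) / s"
    have "l * s = b * (x - x') - a * (y - y')" using \<open>s \<noteq> 0\<close> by (simp add: l_def)
    then have "b * (x' + l * b) + - a * (y' + l * - a) = b * x - a * y"
      by (simp add: s_def power2_eq_square algebra_simps)
    then show ?thesis
      using q P assms True
      by (intro origami_fold[OF q(1) assms(2) _ assms(1) P(1), where k = 0 and l = l])
        (auto simp: algebra_simps)
  next
    case False
    obtain x' y' where P: "a * x' + b * y' = c" "a' * x' + b' * y' = c'"
      using lin_meet_exists[OF q(3)] by (metis mem_lin)
    have P': "origami_point (x', y')"
      using origami_pointI[OF assms(2) q(1,3) P] .
    define s where "s = a\<^sup>2 + b\<^sup>2"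
    have "s \<noteq> 0" using assms(3) by (auto simp: s_def sum_power2_eq_zero_iff)
    define l where "l = (b * (x - x') - a * (y - y')) / s"
    have "l * s = b * (x - x') - a * (y - y')" using \<open>s \<noteq> 0\<close> by (simp add: l_def)
    then have "b * (x' + l * b) + - a * (y' + l * - a) = b * x - a * y"
      by (simp add: s_def power2_eq_square algebra_simps)
    then show ?thesis
      using q P assms False
      by (intro origami_fold[OF assms(2) q(1) _ P' assms(1), where k = l and l = 0])
        (auto simp: algebra_simps)
  qed
qed

lemma origami_parallel:
  assumes "origami_point (x, y)" "origami_line (lin a b c)" "(a, b) \<noteq> (0, 0)"
  shows "origami_line (lin a b (a * x + b * y))"
proof -
  have "origami_line (lin b (- a) (b * x - a * y))"
    using origami_perpendicular[OF assms] .
  from origami_perpendicular[OF assms(1) this]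
  have "origami_line (lin (- a) (- b) (- a * x - b * y))"
    using assms(3) by auto
  then show ?thesis using lin_scale[of "- 1" a b "a * x + b * y"] by simp
qed

lemma origami_vertical: "origami_point (x, y) \<Longrightarrow> origami_line (lin 1 0 x)"
  using origami_parallel[OF _ origami_axes(1)] by fastforce

lemma origami_horizontal: "origami_point (x, y) \<Longrightarrow> origami_line (lin 0 1 y)"
  using origami_parallel[OF _ origami_axes(2)] by fastforce

lemma origami_line_join:
  assumes "origami_point (x1, y1)" "origami_point (x2, y2)" "(x1, y1) \<noteq> (x2, y2)"
    and "(a, b) \<noteq> (0, 0)" "a * x1 + b * y1 = c" "a * x2 + b * y2 = c"
  shows "origami_line (lin a b c)"
  using assms
  \<comment> \<open>Both points lie on the fold line and stay fixed, and the vertical is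
    perpendicular to the horizontal.\<close>
  by (intro origami_fold[OF origami_vertical[OF assms(1)] origami_horizontal[OF assms(2)]
      _ assms(1,2), where k = 0 and l = 0]) auto

section \<open>Origami numbers form a field closed under square roots\<close>

lemma origami_point_iff: "origami_point (x, y) \<longleftrightarrow> x \<in> origami_numbers \<and> y \<in> origami_numbers"
proof -
  have V: "x \<in> origami_numbers \<longleftrightarrow> origami_line (lin 1 0 x)" for x
    unfolding origami_numbers_def
    using origami_vertical origami_pointI[OF _ origami_axes(2), of 1 0 x x 0] by auto
  \<comment> \<open>Parallels to \<open>x + y = 1\<close> carry \<open>(x, 0)\<close> to
    \<open>(0, x)\<close> and back, so both axes carry the same numbers.\<close>
  have H: "x \<in> origami_numbers \<longleftrightarrow> origami_line (lin 0 1 x)" for x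
  proof
    assume "x \<in> origami_numbers"
    then have "origami_line (lin 1 1 x)"
      using origami_parallel[OF _ origami_axes(3), of x 0] by (simp add: origami_numbers_def)
    then have "origami_point (0, x)"
      by (rule origami_pointI[OF _ origami_axes(1)]) auto
    then show "origami_line (lin 0 1 x)" by (rule origami_horizontal)
  next
    assume "origami_line (lin 0 1 x)"
    then have "origami_point (0, x)"
      by (rule origami_pointI[OF _ origami_axes(1)]) auto
    then have "origami_line (lin 1 1 x)"
      using origami_parallel[OF _ origami_axes(3), of 0 x] by simp
    then have "origami_point (x, 0)"
      by (rule origami_pointI[OF _ origami_axes(2)]) auto
    then show "x \<in> origami_numbers" by (simp add: origami_numbers_def)
  qed
  show ?thesis
  proof
    assume "origami_point (x, y)"
    then show "x \<in> origami_numbers \<and> y \<in> origami_numbers"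
      using V H origami_vertical origami_horizontal by blast
  next
    assume "x \<in> origami_numbers \<and> y \<in> origami_numbers"
    then show "origami_point (x, y)"
      using V H by (intro origami_pointI[of 1 0 x 0 1 y]) auto
  qed
qed

lemma origami_0: "0 \<in> origami_numbers" and origami_1: "1 \<in> origami_numbers"
  using origami_corners by (auto simp: origami_numbers_def)

lemma origami_add:
  assumes "x \<in> origami_numbers" "y \<in> origami_numbers"
  shows "x + y \<in> origami_numbers"
proof -
  have "origami_line (lin 1 1 (x + y))"
    using assms origami_parallel[OF _ origami_axes(3), of x y] by (simp add: origami_point_iff)
  then have "origami_point (x + y, 0)"
    by (rule origami_pointI[OF _ origami_axes(2)]) auto
  then show ?thesis by (simp add: origami_point_iff)
qed

text \<open>The perpendicular to \<open>x + y = 1\<close> through \<open>(0, x)\<close> has slope 1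
  and meets the horizontal axis in \<open>(- x, 0)\<close>.\<close>

lemma origami_minus:
  assumes "x \<in> origami_numbers"
  shows "- x \<in> origami_numbers"
proof -
  have "origami_line (lin 1 (- 1) (- x))"
    using assms origami_perpendicular[OF _ origami_axes(3), of 0 x] by (simp add: origami_point_iff origami_0)
  then have "origami_point (- x, 0)"
    by (rule origami_pointI[OF _ origami_axes(2)]) auto
  then show ?thesis by (simp add: origami_point_iff)
qed

text \<open>Similar triangles: the line joining \<open>(1, 0)\<close> and \<open>(0, x)\<close> is
  moved in parallel to pass through \<open>(y, 0)\<close>.\<close>

lemma origami_mult:
  assumes "x \<in> origami_numbers" "y \<in> origami_numbers"
  shows "x * y \<in> origami_numbers"
proof -
  have "origami_line (lin x 1 x)"
    using assms origami_0 origami_1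
    by (intro origami_line_join[of 1 0 0 x]) (auto simp: origami_point_iff)
  from origami_parallel[OF _ this, of y 0] have "origami_line (lin x 1 (x * y))"
    using assms by (simp add: origami_point_iff origami_0)
  then have "origami_point (0, x * y)"
    by (rule origami_pointI[OF _ origami_axes(1)]) auto
  then show ?thesis by (simp add: origami_point_iff)
qed

text \<open>Similar triangles again: the line joining \<open>(x, 0)\<close> and
  \<open>(0, 1)\<close> is moved to pass through \<open>(1, 0)\<close>. For 0 the convention
  \<open>inverse 0 = 0\<close> applies.\<close>

lemma origami_inverse:
  assumes "x \<in> origami_numbers"
  shows "inverse x \<in> origami_numbers"
proof (cases "x = 0")
  case False
  have "origami_line (lin 1 x x)"
    using assms origami_0 origami_1 False
    by (intro origami_line_join[of x 0 0 1]) (auto simp: origami_point_iff)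
  from origami_parallel[OF _ this, of 1 0] have "origami_line (lin 1 x 1)"
    by (simp add: origami_point_iff origami_0 origami_1)
  then have "origami_point (0, inverse x)"
    by (rule origami_pointI[OF _ origami_axes(1)]) (auto simp: False)
  then show ?thesis by (simp add: origami_point_iff)
qed (simp add: origami_0)

text \<open>The circle with diameter from \<open>(-1, 0)\<close> to \<open>(r, 0)\<close> meets the \<open>y\<close>-axis in \<open>(0, sqrt r)\<close>; the fold
  through its centre carries \<open>(r, 0)\<close> to that point and meets \<open>x = r / 2\<close> in \<open>(r / 2, sqrt r / 2)\<close>.\<close>

lemma origami_sqrt:
  assumes "r \<in> origami_numbers" "r \<ge> 0"
  shows "sqrt r \<in> origami_numbers"
proof (cases "r = 0")
  case False
  define s where "s = sqrt r"
  have s: "s > 0" "r = s * s" using assms False by (auto simp: s_def)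
  have half: "x / 2 \<in> origami_numbers" if "x \<in> origami_numbers" for x
    using origami_mult[OF that origami_inverse[OF origami_add[OF origami_1 origami_1]]]
    by (simp add: field_simps)
  have P: "origami_point (r, 0)" "origami_point ((r - 1) / 2, 0)"
    using half[OF origami_add[OF assms(1) origami_minus[OF origami_1]]] assms(1)
    by (auto simp: origami_point_iff origami_0)
  \<comment> \<open>Needed for \<open>P\<close> and \<open>Q\<close> to be distinct:
    \<open>(r, 0)\<close> is the centre \<open>((r - 1) / 2, 0)\<close> only if
    \<open>r = - 1\<close>.\<close>
  have "1 + s * s \<noteq> 0" using s(1) by (simp add: add_nonneg_eq_0_iff)
  then have "origami_line (lin s (- 1) (s * (r - 1) / 2))"
    using s by (intro origami_fold[OF origami_axes(1,2) _ P, where k = "- s / 2" and l = 0])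
      (auto simp: field_simps)
  moreover have "origami_line (lin 1 0 (r / 2))"
    using origami_vertical[of "r / 2" 0] half assms(1) by (simp add: origami_point_iff origami_0)
  ultimately have "origami_point (r / 2, s / 2)"
    by (rule origami_pointI) (auto simp: field_simps)
  then have "s / 2 + s / 2 \<in> origami_numbers"
    by (intro origami_add) (simp_all only: origami_point_iff)
  then show ?thesis by (simp add: s_def)
qed (simp add: origami_0)

section \<open>Coordinates of straightedge-and-compass points\<close>

text \<open>Separates the compass half from origami: only these closure properties enter
  below.\<close>

locale sqrt_closed_subfield =
  fixes K :: "real set"
  assumes zero: "0 \<in> K" and one: "1 \<in> K"
    and add: "\<And>x y. x \<in> K \<Longrightarrow> y \<in> K \<Longrightarrow> x + y \<in> K"
    and minus: "\<And>x. x \<in> K \<Longrightarrow> - x \<in> K"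
    and mult: "\<And>x y. x \<in> K \<Longrightarrow> y \<in> K \<Longrightarrow> x * y \<in> K"
    and inverse: "\<And>x. x \<in> K \<Longrightarrow> inverse x \<in> K"
    and sqrt: "\<And>x. x \<in> K \<Longrightarrow> x \<ge> 0 \<Longrightarrow> sqrt x \<in> K"
begin

section \<open>Quadratic equations and intersections over \<open>K\<close>\<close>

lemma diff: "x \<in> K \<Longrightarrow> y \<in> K \<Longrightarrow> x - y \<in> K"
  using add[OF _ minus, of x y] by simp

lemma divide: "x \<in> K \<Longrightarrow> y \<in> K \<Longrightarrow> x / y \<in> K"
  using mult[OF _ inverse, of x y] by (simp add: divide_inverse)

lemma power2: "x \<in> K \<Longrightarrow> x\<^sup>2 \<in> K"
  by (simp add: power2_eq_square mult)

lemma numeral: "numeral n \<in> K"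
  by (induction n) (simp_all only: numeral.simps one add)

lemmas closure = zero one add minus mult diff divide power2 numeral

text \<open>Completing the square: the discriminant is the square of \<open>2 * A * x + B\<close>,
  hence nonnegative. Its root gives that number up to sign, and \<open>K\<close> is closed under
  negation.\<close>

lemma quadratic_root:
  assumes "A \<in> K" "B \<in> K" "C \<in> K" "A \<noteq> 0" "A * x\<^sup>2 + B * x + C = 0"
  shows "x \<in> K"
proof -
  have "(2 * A * x + B)\<^sup>2 = B\<^sup>2 - 4 * A * C + 4 * A * (A * x\<^sup>2 + B * x + C)"
    by (simp add: power2_eq_square algebra_simps)
  then have D: "(2 * A * x + B)\<^sup>2 = B\<^sup>2 - 4 * A * C" by (simp add: assms(5))
  then have "sqrt (B\<^sup>2 - 4 * A * C) = \<bar>2 * A * x + B\<bar>"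
    by (metis real_sqrt_abs)
  moreover have "sqrt (B\<^sup>2 - 4 * A * C) \<in> K"
    using assms(1-3) by (intro sqrt closure) (auto simp flip: D)
  moreover have "z \<in> K" if "\<bar>z\<bar> \<in> K" for z
    using that minus[OF that] by (cases "z \<ge> 0") auto
  ultimately have "2 * A * x + B \<in> K"
    by metis
  then have "(2 * A * x + B - B) / (2 * A) \<in> K"
    using assms(1,2) by (intro divide[OF diff mult[OF numeral]])
  then show ?thesis using assms(4) by simp
qed

lemma line_line_point:
  assumes "a \<in> K" "b \<in> K" "c \<in> K" "a' \<in> K" "b' \<in> K" "c' \<in> K" "a * b' \<noteq> a' * b"
    and "a * x + b * y = c" "a' * x + b' * y = c'"
  shows "x \<in> K" "y \<in> K"
proof -
  have "x = (c * b' - c' * b) / (a * b' - a' * b)" "y = (a * c' - a' * c) / (a * b' - a' * b)"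
    using assms(7) by (simp_all add: field_simps flip: assms(8,9))
  then show "x \<in> K" "y \<in> K" using assms by (auto intro!: closure)
qed

text \<open>Eliminating \<open>y\<close> and multiplying by \<open>b\<^sup>2\<close> leaves a
  quadratic equation for \<open>x\<close> with leading coefficient
  \<open>b\<^sup>2 + a\<^sup>2\<close>.\<close>

lemma line_circle_point_aux:
  assumes "a \<in> K" "b \<in> K" "c \<in> K" "d \<in> K" "e \<in> K" "f \<in> K" "b \<noteq> 0"
    and "a * x + b * y = c" "x\<^sup>2 + y\<^sup>2 + d * x + e * y = f"
  shows "x \<in> K" "y \<in> K"
proof -
  have y: "y = (c - a * x) / b" using assms(7,8) by (simp add: field_simps)
  have by_eq: "b * y = c - a * x" using assms(8) by simp
  have "(b\<^sup>2 + a\<^sup>2) * x\<^sup>2 + (b\<^sup>2 * d - 2 * a * c - e * a * b) * x + (c\<^sup>2 + e * b * c - b\<^sup>2 * f)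
    = b\<^sup>2 * x\<^sup>2 + (c - a * x)\<^sup>2 + b\<^sup>2 * d * x + e * b * (c - a * x) - b\<^sup>2 * f"
    by (simp add: power2_eq_square algebra_simps)
  also have "\<dots> = b\<^sup>2 * (x\<^sup>2 + y\<^sup>2 + d * x + e * y - f)"
    unfolding by_eq[symmetric] by (simp add: power2_eq_square algebra_simps)
  finally have root: "(b\<^sup>2 + a\<^sup>2) * x\<^sup>2 + (b\<^sup>2 * d - 2 * a * c - e * a * b) * x + (c\<^sup>2 + e * b * c - b\<^sup>2 * f) = 0"
    by (simp add: assms(9))
  have "b\<^sup>2 + a\<^sup>2 \<noteq> 0" using assms(7) by (simp add: sum_power2_eq_zero_iff)
  then show "x \<in> K"
    by (intro quadratic_root[OF _ _ _ _ root] closure assms(1-6))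
  then show "y \<in> K" unfolding y by (intro closure assms(1-6))
qed

lemma line_circle_point:
  assumes "a \<in> K" "b \<in> K" "c \<in> K" "d \<in> K" "e \<in> K" "f \<in> K" "(a, b) \<noteq> (0, 0)"
    and "a * x + b * y = c" "x\<^sup>2 + y\<^sup>2 + d * x + e * y = f"
  shows "x \<in> K" "y \<in> K"
proof -
  have "x \<in> K \<and> y \<in> K"
  proof (cases "b = 0")
    case False
    then show ?thesis using line_circle_point_aux[OF assms(1-6) _ assms(8,9)] by blast
  next
    \<comment> \<open>Here \<open>a\<close> is nonzero, and the two coordinates exchange their
      roles.\<close>
    case True
    then show ?thesis
      using line_circle_point_aux[OF assms(2,1,3,5,4,6), of y x] assms(7-9)
      by (auto simp: algebra_simps)
  qed
  then show "x \<in> K" "y \<in> K" by auto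
qed

section \<open>Lines, circles and construction steps with coordinates in \<open>K\<close>\<close>

lemma lines_of_coordinates:
  assumes "S \<subseteq> K \<times> K" "l \<in> lines_of S"
  obtains a b c where "a \<in> K" "b \<in> K" "c \<in> K" "(a, b) \<noteq> (0, 0)" "l = lin a b c"
proof -
  obtain P Q where PQ: "P \<in> S" "Q \<in> S" "P \<noteq> Q" "l = line_through P Q"
    using assms(2) unfolding lines_of_def by blast
  obtain x1 y1 where P: "P = (x1, y1)" "x1 \<in> K" "y1 \<in> K"
    using PQ(1) assms(1) by blast
  obtain x2 y2 where Q: "Q = (x2, y2)" "x2 \<in> K" "y2 \<in> K"
    using PQ(2) assms(1) by blast
  show ?thesis
  proof (rule that)
    show "l = lin (y2 - y1) (x1 - x2) ((y2 - y1) * x1 + (x1 - x2) * y1)"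
      using line_through_eq_lin PQ(3,4) P(1) Q(1) by simp
    show "(y2 - y1, x1 - x2) \<noteq> (0, 0)"
      using PQ(3) P(1) Q(1) by auto
  qed (intro closure P Q)+
qed

lemma circles_of_coordinates:
  assumes "S \<subseteq> K \<times> K" "C \<in> circles_of S"
  obtains d e f where "d \<in> K" "e \<in> K" "f \<in> K" "C = {(x, y). x\<^sup>2 + y\<^sup>2 + d * x + e * y = f}"
proof -
  obtain P Q where PQ: "P \<in> S" "Q \<in> S" "C = circle_through P Q"
    using assms(2) unfolding circles_of_def by blast
  obtain x1 y1 where P: "P = (x1, y1)" "x1 \<in> K" "y1 \<in> K"
    using PQ(1) assms(1) by blast
  obtain x2 y2 where Q: "Q = (x2, y2)" "x2 \<in> K" "y2 \<in> K"
    using PQ(2) assms(1) by blast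
  \<comment> \<open>Only the squared radius enters, and its terms
    \<open>x1\<^sup>2 + y1\<^sup>2\<close> cancel against those of the centre.\<close>
  have "C = {(x, y). x\<^sup>2 + y\<^sup>2 + - (2 * x1) * x + - (2 * y1) * y = x2\<^sup>2 + y2\<^sup>2 - 2 * x1 * x2 - 2 * y1 * y2}"
    by (auto simp: PQ(3) P(1) Q(1) circle_through_def dist_Pair_Pair dist_real_def power2_eq_square algebra_simps)
  then show ?thesis
    by (rule that[rotated 3]) (intro closure P Q)+
qed

lemma zul_step_coordinates:
  assumes S: "S \<subseteq> K \<times> K" and "zul_step S X"
  shows "X \<in> K \<times> K"
proof -
  obtain x y where X: "X = (x, y)" by (cases X)
  consider (ll) l m where "l \<in> lines_of S" "m \<in> lines_of S" "l \<noteq> m" "X \<in> l" "X \<in> m"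
    | (lc) l C where "l \<in> lines_of S" "C \<in> circles_of S" "X \<in> l" "X \<in> C"
    | (cc) C D where "C \<in> circles_of S" "D \<in> circles_of S" "C \<noteq> D" "X \<in> C" "X \<in> D"
    using assms(2) unfolding zul_step_def by (elim disjE bexE conjE IntE)
  then show ?thesis
  proof cases
    case ll
    obtain a b c where l: "a \<in> K" "b \<in> K" "c \<in> K" "(a, b) \<noteq> (0, 0)" "l = lin a b c"
      using lines_of_coordinates[OF S ll(1)] .
    obtain a' b' c' where m: "a' \<in> K" "b' \<in> K" "c' \<in> K" "(a', b') \<noteq> (0, 0)" "m = lin a' b' c'"
      using lines_of_coordinates[OF S ll(2)] .
    have "a * b' \<noteq> a' * b"
      using lin_eq_of_parallel[OF l(4) m(4)] ll(3-5) l m X by blast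
    then show ?thesis
      using line_line_point[OF l(1-3) m(1-3)] ll(4,5) l m X by auto
  next
    case lc
    obtain a b c where l: "a \<in> K" "b \<in> K" "c \<in> K" "(a, b) \<noteq> (0, 0)" "l = lin a b c"
      using lines_of_coordinates[OF S lc(1)] .
    obtain d e f where C: "d \<in> K" "e \<in> K" "f \<in> K" "C = {(x, y). x\<^sup>2 + y\<^sup>2 + d * x + e * y = f}"
      using circles_of_coordinates[OF S lc(2)] .
    show ?thesis
      using line_circle_point[OF l(1-3) C(1-3) l(4)] lc(3,4) l(5) C(4) X by auto
  next
    case cc
    obtain d e f where C: "d \<in> K" "e \<in> K" "f \<in> K" "C = {(x, y). x\<^sup>2 + y\<^sup>2 + d * x + e * y = f}"
      using circles_of_coordinates[OF S cc(1)] .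
    obtain d' e' f' where D: "d' \<in> K" "e' \<in> K" "f' \<in> K" "D = {(x, y). x\<^sup>2 + y\<^sup>2 + d' * x + e' * y = f'}"
      using circles_of_coordinates[OF S cc(2)] .
    have eq: "x\<^sup>2 + y\<^sup>2 + d * x + e * y = f" "x\<^sup>2 + y\<^sup>2 + d' * x + e' * y = f'"
      using cc C D X by auto
    \<comment> \<open>The radical axis: subtracting the equations reduces two circles to a line and
      a circle.\<close>
    then have radical: "(d - d') * x + (e - e') * y = f - f'"
      by (simp add: algebra_simps)
    \<comment> \<open>Concentric circles with a common point coincide, so the radical axis is a
      genuine line.\<close>
    moreover have "(d - d', e - e') \<noteq> (0, 0)"
    proof
      assume "(d - d', e - e') = (0, 0)"
      then have "d = d'" "e = e'" "f = f'" using radical by auto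
      then show False using C D cc(3) by simp
    qed
    moreover have "d - d' \<in> K" "e - e' \<in> K" "f - f' \<in> K"
      using C D by (auto intro: diff)
    ultimately show ?thesis
      using line_circle_point[OF _ _ _ C(1-3) _ _ eq(1)] X by blast
  qed
qed

lemma zul_point_coordinates:
  assumes "zul_point P"
  shows "P \<in> K \<times> K"
proof -
  obtain Ps where Ps: "Ps \<noteq> []" "zul_sequence Ps" "last Ps = P"
    using assms by (auto simp: zul_point_def)
  have "Ps ! i \<in> K \<times> K" if "i < length Ps" for i
    using that
  proof (induction i rule: less_induct)
    case (less i)
    have sub: "set (take i Ps) \<subseteq> K \<times> K"
    proof
      fix X assume "X \<in> set (take i Ps)"
      then obtain j where "j < i" "j < length Ps" "X = Ps ! j"
        by (auto simp: in_set_conv_nth)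
      then show "X \<in> K \<times> K" using less.IH by simp
    qed
    have "Ps ! i \<in> {(0, 0), (0, 1)} \<or> zul_step (set (take i Ps)) (Ps ! i)"
      using Ps(2) less.prems by (auto simp: zul_sequence_def)
    then show ?case
    proof
      assume "Ps ! i \<in> {(0, 0), (0, 1)}"
      then show ?case using zero one by auto
    qed (rule zul_step_coordinates[OF sub])
  qed
  then show ?thesis using Ps by (auto simp: last_conv_nth)
qed

end

theorem mainTheorem1:
  shows "zul_numbers \<subseteq> origami_numbers"
proof -
  interpret sqrt_closed_subfield origami_numbers
    by unfold_locales
      (fact origami_0 origami_1 origami_add origami_minus origami_mult origami_inverse origami_sqrt)+
  show ?thesis using zul_point_coordinates by (auto simp: zul_numbers_def)
qed

end
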